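(* Let $n$ be a squarefree positive integer which is not a prime and assume that every prime divisor of $n$ is at least $7$. Then a sequence in $\mathbb{Z}_n$ is a $C$-extremal sequence for $S(n)$ if and only if it is a $C$-extremal sequence for $U(n)$.
   Context: $\mathbb{Z}_n$ denotes the ring $\mathbb{Z}/n\mathbb{Z}$ and $U(n)$ its group of units. For odd $n$ and $x\in U(n)$, $\left(\frac{x}{n}\right)$ denotes the Jacobi symbol, and $S(n)=\{x\in U(n):\left(\frac{x}{n}\right)=1\}$. For $A\subseteq\mathbb{Z}_n$, a (nonempty, finite) sequence $(y_1,\ldots,y_k)$ in $\mathbb{Z}_n$ is an $A$-weighted zero-sum sequence if there exist $a_1,\ldots,a_k\in A$ with $a_1y_1+\cdots+a_ky_k=0$. The constant $C_A(n)$ is the least positive integer $k$ such that every sequence of length $k$ in $\mathbb{Z}_n$ has a (nonempty) subsequence of consecutive terms that is an $A$-weighted zero-sum sequence. If $0\notin A$, a $C$-extremal sequence for $A$ is a sequence in $\mathbb{Z}_n$ of length $C_A(n)-1$ which has no $A$-weighted zero-sum subsequence of consecutive terms. *)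

theory Defs
  imports
    "HOL-Number_Theory.Number_Theory"
    "HOL-Computational_Algebra.Squarefree"
    "HOL-Library.Sublist"
begin

text \<open>
  Elements of $\mathbb{Z}/n\mathbb{Z}$ are represented by their least nonnegative residues, and
  the ring operations by integer arithmetic up to \<open>cong\<close>. For \<open>n > 1\<close> this is the
  ring \<open>residue_ring (int n)\<close>; that record has \<open>\<one> = 1\<close> even for
  \<open>n = 1\<close>, where \<open>1\<close> is not in its carrier, so its \<open>Units\<close> would be
  empty there instead of being the trivial group.
\<close>

definition Zmod :: "nat \<Rightarrow> int set" where
  "Zmod n = {0..<int n}"

definition unit_residues :: "nat \<Rightarrow> int set" where
  "unit_residues n = {x \<in> Zmod n. \<exists>y\<in>Zmod n. [x * y = 1] (mod int n)}"

definition Jacobi :: "int \<Rightarrow> nat \<Rightarrow> int" where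
  "Jacobi a n = (\<Prod>p\<in>#prime_factorization n. Legendre a (int p))"

definition Jacobi_one_residues :: "nat \<Rightarrow> int set" where
  "Jacobi_one_residues n = {x \<in> unit_residues n. Jacobi x n = 1}"

definition weighted_zero_sum :: "nat \<Rightarrow> int set \<Rightarrow> int list \<Rightarrow> bool" where
  "weighted_zero_sum n A ys \<longleftrightarrow> ys \<noteq> [] \<and>
     (\<exists>as. length as = length ys \<and> set as \<subseteq> A \<and>
           [(\<Sum>i<length ys. as ! i * ys ! i) = 0] (mod int n))"

text \<open>
  \<open>sublist\<close> is the contiguous notion (\<open>subseq\<close> is the scattered one). It admits the
  empty list, which \<open>weighted_zero_sum\<close> excludes.
\<close>

definition has_consecutive_zero_sum :: "nat \<Rightarrow> int set \<Rightarrow> int list \<Rightarrow> bool" where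
  "has_consecutive_zero_sum n A ys \<longleftrightarrow> (\<exists>zs. sublist zs ys \<and> weighted_zero_sum n A zs)"

definition C_const :: "nat \<Rightarrow> int set \<Rightarrow> nat" where
  "C_const n A = (LEAST k. k > 0 \<and>
     (\<forall>ys. set ys \<subseteq> Zmod n \<and> length ys = k \<longrightarrow> has_consecutive_zero_sum n A ys))"

text \<open>
  Extremal sequences are usually considered for \<open>0 \<notin> A\<close> only. No such guard is put into
  the definition: for \<open>0 \<in> A\<close> the constant is 1 and only the empty sequence is extremal.
\<close>

definition C_extremal :: "nat \<Rightarrow> int set \<Rightarrow> int list \<Rightarrow> bool" where
  "C_extremal n A ys \<longleftrightarrow> set ys \<subseteq> Zmod n \<and> length ys = C_const n A - 1 \<and>
     \<not> has_consecutive_zero_sum n A ys"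

lemma unit_residues_eq_Units:
  assumes "n > 1"
  shows "unit_residues n = Units (residue_ring (int n))"
proof -
  have "Zmod n = carrier (residue_ring (int n))"
    by (auto simp: Zmod_def residue_ring_def)
  then show ?thesis
    using assms by (auto simp: unit_residues_def Units_def residue_ring_def cong_def mult.commute)
qed

lemma unit_residues_eq_coprime:
  assumes "n > 0"
  shows "unit_residues n = {x \<in> Zmod n. coprime x (int n)}"
proof (rule Set.set_eqI, rule iffI)
  fix x assume "x \<in> unit_residues n"
  then show "x \<in> {x \<in> Zmod n. coprime x (int n)}"
    by (auto simp: unit_residues_def coprime_iff_invertible_int)
next
  fix x assume x: "x \<in> {x \<in> Zmod n. coprime x (int n)}"
  then obtain y where "[x * y = 1] (mod int n)"
    by (auto simp: coprime_iff_invertible_int)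
  then have "[x * (y mod int n) = 1] (mod int n)"
    by (simp add: cong_def mod_mult_right_eq)
  moreover have "y mod int n \<in> Zmod n"
    using assms by (simp add: Zmod_def)
  ultimately show "x \<in> unit_residues n"
    using x by (auto simp: unit_residues_def)
qed

lemma zero_not_unit_residue:
  assumes "n > 1"
  shows "0 \<notin> unit_residues n" "0 \<notin> Jacobi_one_residues n"
  using assms by (auto simp: unit_residues_def Jacobi_one_residues_def cong_def)

end

theory Submission
  imports Defs
begin

text \<open>
  By the Chinese remainder theorem the weights may be chosen modulo each prime divisor of \<open>n\<close>
  separately, subject to the Legendre symbols of each weight multiplying to 1. The symbol at a
  prime \<open>p\<close> can be prescribed for free at a term divisible by \<open>p\<close>, and at all terms
  simultaneously if at least three terms are prime to \<open>p\<close>, since for \<open>p \<ge> 7\<close> the form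
  $x a^2 + y b^2 + z c^2$ takes every value with $a, b, c$ nonzero modulo $p$.

  Hence for sequences of length at least 3, having a consecutive zero-sum with weights in
  \<open>U(n)\<close> or in \<open>S(n)\<close> is the same. A zero term is trivial. If two terms of the whole
  sequence are units, then a third, nonzero, term yields a prime with three terms prime to it, and
  the whole sequence is an \<open>S(n)\<close>-weighted zero-sum. Otherwise a \<open>U(n)\<close>-weighted
  zero-sum block has at most one unit; its weight can be scaled to 1 and the other signs are free.
  Finally \<open>(p, 1, p)\<close> shows that the constants exceed 3, so they agree and the extremal
  sequences have length at least 3.
\<close>

section \<open>Quadratic forms over a prime field with nonzero arguments\<close>

lemma prime_inverse_mod:
  fixes p a :: int
  assumes "prime p" "\<not> p dvd a"
  obtains c where "[a * c = 1] (mod p)" "\<not> p dvd c"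
proof -
  have "coprime a p"
    using assms by (metis coprime_commute prime_imp_coprime)
  then obtain c where c: "[a * c = 1] (mod p)"
    by (metis coprime_iff_invertible_int)
  have "\<not> p dvd c"
  proof
    assume "p dvd c"
    then have "[a * c = 0] (mod p)"
      by (simp add: cong_0_iff)
    with c have "[1 = 0] (mod p)"
      by (metis cong_sym cong_trans)
    with assms(1) show False
      using cong_0_iff not_prime_unit by blast
  qed
  with c that show thesis by blast
qed

section \<open>Legendre symbols modulo a prime\<close>

lemma Legendre_cong:
  assumes "[a = b] (mod p)"
  shows "Legendre a p = Legendre b p"
  using assms by (simp add: Legendre_def QuadRes_def cong_def)

text \<open>Multiplication by \<open>a\<close>, and by its inverse \<open>c\<close>, carries square
  roots of \<open>r\<close> to square roots of \<open>r * a\<^sup>2\<close> and back. This lets a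
  weight with a prescribed symbol be varied by square factors.\<close>

lemma Legendre_mult_square:
  fixes p r a :: int
  assumes p: "prime p" and a: "\<not> p dvd a"
  shows "Legendre (r * a\<^sup>2) p = Legendre r p"
proof -
  obtain c where c: "[a * c = 1] (mod p)"
    using prime_inverse_mod[OF assms] by blast
  have "QuadRes p (r * a\<^sup>2) \<longleftrightarrow> QuadRes p r"
  proof
    assume "QuadRes p (r * a\<^sup>2)"
    then obtain y where "[y\<^sup>2 = r * a\<^sup>2] (mod p)"
      by (auto simp: QuadRes_def)
    then have "[y\<^sup>2 * c\<^sup>2 = r * a\<^sup>2 * c\<^sup>2] (mod p)"
      by (rule cong_scalar_right)
    then have "[(y * c)\<^sup>2 = r * (a * c)\<^sup>2] (mod p)"
      by (simp add: power_mult_distrib mult_ac)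
    also have "[r * (a * c)\<^sup>2 = r * 1\<^sup>2] (mod p)"
      by (intro cong_scalar_left cong_pow c)
    finally show "QuadRes p r"
      by (auto simp: QuadRes_def)
  next
    assume "QuadRes p r"
    then obtain y where "[y\<^sup>2 = r] (mod p)"
      by (auto simp: QuadRes_def)
    then have "[y\<^sup>2 * a\<^sup>2 = r * a\<^sup>2] (mod p)"
      by (rule cong_scalar_right)
    then have "[(y * a)\<^sup>2 = r * a\<^sup>2] (mod p)"
      by (simp add: power_mult_distrib)
    then show "QuadRes p (r * a\<^sup>2)"
      by (auto simp: QuadRes_def)
  qed
  moreover have "[r * a\<^sup>2 = 0] (mod p) \<longleftrightarrow> [r = 0] (mod p)"
    using assms by (auto simp: cong_0_iff prime_dvd_mult_iff prime_dvd_power_iff)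
  ultimately show ?thesis
    by (simp add: Legendre_def)
qed

lemma Legendre_1:
  fixes p :: int
  assumes "prime p"
  shows "Legendre 1 p = 1"
proof -
  have "QuadRes p 1"
    unfolding QuadRes_def by (intro exI[of _ 1]) simp
  then show ?thesis
    using assms not_prime_unit[of p] by (auto simp: Legendre_def cong_0_iff)
qed

lemma Legendre_unit:
  assumes "\<not> p dvd a"
  shows "Legendre a p \<in> {1, -1}"
  using assms by (auto simp: Legendre_def cong_0_iff)

lemma Legendre_nonzero:
  assumes "Legendre a p \<in> {1, -1}"
  shows "\<not> p dvd a"
  using assms by (auto simp: Legendre_def cong_0_iff)

text \<open>Otherwise squaring is surjective on the finite set of residues, hence injective,
  although 1 and -1 have the same square and differ for p > 2.\<close>

lemma exists_nonresidue:
  fixes p :: int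
  assumes "prime p" "p > 2"
  shows "\<exists>r. Legendre r p = -1"
proof (rule ccontr)
  assume *: "\<nexists>r. Legendre r p = -1"
  let ?f = "\<lambda>y. y\<^sup>2 mod p"
  have "{0..<p} \<subseteq> ?f ` {0..<p}"
  proof
    fix r assume r: "r \<in> {0..<p}"
    have "QuadRes p r"
    proof (cases "r = 0")
      case True
      then show ?thesis
        unfolding QuadRes_def by (intro exI[of _ 0]) simp
    next
      case False
      then have "\<not> p dvd r"
        using r by (auto dest: zdvd_imp_le)
      then show ?thesis
        using * Legendre_unit[of p r] by (auto simp: Legendre_def split: if_splits)
    qed
    then obtain y where "[y\<^sup>2 = r] (mod p)"
      by (auto simp: QuadRes_def)
    then have "?f (y mod p) = r"
      using r by (simp add: cong_def power_mod)
    moreover have "y mod p \<in> {0..<p}"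
      using assms by simp
    ultimately show "r \<in> ?f ` {0..<p}"
      by blast
  qed
  moreover have "?f ` {0..<p} \<subseteq> {0..<p}"
    using assms by auto
  ultimately have "?f ` {0..<p} = {0..<p}"
    by blast
  then have "inj_on ?f {0..<p}"
    by (intro eq_card_imp_inj_on) auto
  moreover have "?f 1 = ?f (p - 1)"
    by (simp add: power2_eq_square algebra_simps mod_simps)
      (metis mod_mult_self2 diff_add_cancel)
  moreover have "1 \<in> {0..<p}" "p - 1 \<in> {0..<p}"
    using assms by auto
  ultimately have "1 = p - 1"
    by (meson inj_onD)
  with assms show False by simp
qed

lemma exists_Legendre_eq:
  fixes p e :: int
  assumes "prime p" "p > 2" "e \<in> {1, -1}"
  shows "\<exists>r. Legendre r p = e"
  using assms Legendre_1 exists_nonresidue by blast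

section \<open>Values of diagonal quadratic forms\<close>

lemma prime_cong_square_iff:
  fixes p a b :: int
  assumes "prime p"
  shows "[a\<^sup>2 = b\<^sup>2] (mod p) \<longleftrightarrow> [a = b] (mod p) \<or> [a = - b] (mod p)"
proof -
  have "a\<^sup>2 - b\<^sup>2 = (a - b) * (a + b)"
    by (simp add: power2_eq_square algebra_simps)
  then show ?thesis
    using assms by (simp add: cong_iff_dvd_diff prime_dvd_mult_iff)
qed

lemma prime_cong_mult_lcancel:
  fixes p x a b :: int
  assumes "prime p" "\<not> p dvd x"
  shows "[x * a = x * b] (mod p) \<longleftrightarrow> [a = b] (mod p)"
  using assms by (metis cong_mult_lcancel coprime_commute prime_imp_coprime)

text \<open>The range 0..(p-1)/2 contains no two distinct residues that agree up to sign, so any map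
  whose value determines the square of its argument is injective there. A general \<open>f\<close>
  serves both value sets in the pigeonhole argument that follows.\<close>

lemma inj_on_square_residues:
  fixes p :: int
  assumes "prime p" "p > 2"
    and f: "\<And>a b. [f a = f b] (mod p) \<Longrightarrow> [a\<^sup>2 = b\<^sup>2] (mod p)"
  shows "inj_on (\<lambda>a. f a mod p) {0..(p - 1) div 2}"
proof (rule inj_onI)
  fix a b assume ab: "a \<in> {0..(p - 1) div 2}" "b \<in> {0..(p - 1) div 2}" and "f a mod p = f b mod p"
  then have "[a\<^sup>2 = b\<^sup>2] (mod p)"
    by (intro f) (simp add: cong_def)
  then consider "p dvd a - b" | "p dvd a + b"
    using prime_cong_square_iff[OF assms(1)] by (auto simp: cong_iff_dvd_diff)
  then show "a = b"
  proof cases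
    case 1
    have "\<bar>a - b\<bar> < p" using ab assms(2) by auto
    with 1 show ?thesis
      using dvd_imp_le_int[of "a - b" p] by fastforce
  next
    case 2
    \<comment> \<open>Both are at most (p-1)/2, so their sum stays below p and can only vanish with
      both equal to 0.\<close>
    have "\<bar>a + b\<bar> < p" using ab assms(2) by auto
    with 2 have "a + b = 0"
      using dvd_imp_le_int[of "a + b" p] by fastforce
    with ab show ?thesis by auto
  qed
qed

text \<open>Pigeonhole: the values \<open>x * a\<^sup>2\<close> and the values
  \<open>s - y * b\<^sup>2\<close> each fill (p+1)/2 of the p residues, so the two sets meet. The
  arguments may still be 0 here.\<close>

lemma binary_form_represents:
  fixes p x y s :: int
  assumes p: "prime p" "p > 2" and xy: "\<not> p dvd x" "\<not> p dvd y"
  shows "\<exists>a b. [x * a\<^sup>2 + y * b\<^sup>2 = s] (mod p)"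
proof -
  let ?H = "{0..(p - 1) div 2}"
  let ?F = "(\<lambda>a. (x * a\<^sup>2) mod p) ` ?H" and ?G = "(\<lambda>b. (s - y * b\<^sup>2) mod p) ` ?H"
  have "odd p"
    using p prime_odd_int by blast
  have "card ?F = card ?H"
    by (rule card_image, rule inj_on_square_residues[OF p])
      (use p xy in \<open>simp add: prime_cong_mult_lcancel\<close>)
  moreover have "card ?G = card ?H"
  proof (rule card_image, rule inj_on_square_residues[OF p])
    fix a b assume "[s - y * a\<^sup>2 = s - y * b\<^sup>2] (mod p)"
    then have "[s - (s - y * a\<^sup>2) = s - (s - y * b\<^sup>2)] (mod p)"
      by (rule cong_diff[OF cong_refl])
    then have "[y * a\<^sup>2 = y * b\<^sup>2] (mod p)"
      by simp
    then show "[a\<^sup>2 = b\<^sup>2] (mod p)"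
      using p xy by (simp add: prime_cong_mult_lcancel)
  qed
  moreover have "?F \<union> ?G \<subseteq> {0..<p}"
    using p by auto
  then have "card (?F \<union> ?G) \<le> nat p"
    using card_mono[of "{0..<p}" "?F \<union> ?G"] by simp
  ultimately have "?F \<inter> ?G \<noteq> {}"
    using card_Un_disjoint[of ?F ?G] \<open>odd p\<close> p by (auto elim!: oddE simp: nat_add_distrib nat_mult_distrib)
  then obtain a b where "[x * a\<^sup>2 = s - y * b\<^sup>2] (mod p)"
    by (auto simp: cong_def)
  then have "[x * a\<^sup>2 + y * b\<^sup>2 = s - y * b\<^sup>2 + y * b\<^sup>2] (mod p)"
    by (intro cong_add cong_refl)
  then show ?thesis
    by auto
qed

text \<open>The line of slope \<open>m\<close> through the point \<open>(0, b)\<close> of the conic meets it in a second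
  point, and one of the slopes 1, 2, 3 keeps both of its coordinates nonzero.\<close>

lemma conic_second_point:
  fixes p x y s b :: int
  assumes p: "prime p" "p \<ge> 7" and nz: "\<not> p dvd x" "\<not> p dvd y" "\<not> p dvd s"
    and b: "[y * b\<^sup>2 = s] (mod p)"
  shows "\<exists>a c. \<not> p dvd a \<and> \<not> p dvd c \<and> [x * a\<^sup>2 + y * c\<^sup>2 = s] (mod p)"
proof -
  have p2: "\<not> p dvd 2" "\<not> p dvd 3" "\<not> p dvd 5"
    using p by (auto dest!: zdvd_imp_le)
  have "\<not> p dvd 8"
    using p(1) p2(1) prime_dvd_power[of p 2 3] by auto
  with p2 have k: "\<not> p dvd 3 * y" "\<not> p dvd 5 * y" "\<not> p dvd 8 * y"
    using p(1) nz(2) by (auto simp: prime_dvd_mult_iff)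
  \<comment> \<open>If all three slopes failed, two of them would fail with the same sign, and
    subtracting would make p divide 3y, 5y or 8y up to sign.\<close>
  have "\<exists>m\<in>{1, 2, 3}. \<not> p dvd x + y * m\<^sup>2 \<and> \<not> p dvd x - y * m\<^sup>2"
  proof (rule ccontr)
    assume "\<not> ?thesis"
    then have *: "p dvd x + y \<or> p dvd x - y" "p dvd x + y * 4 \<or> p dvd x - y * 4"
        "p dvd x + y * 9 \<or> p dvd x - y * 9"
      by simp_all
    have diff: "\<not> (p dvd u \<and> p dvd v)" if "u - v \<in> {3 * y, 5 * y, 8 * y}" for u v
      using k that dvd_diff[of p u v] by fastforce
    have "\<not> (p dvd x + y * 4 \<and> p dvd x + y)" "\<not> (p dvd x + y * 9 \<and> p dvd x + y)"
        "\<not> (p dvd x + y * 9 \<and> p dvd x + y * 4)" "\<not> (p dvd x - y \<and> p dvd x - y * 4)"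
        "\<not> (p dvd x - y \<and> p dvd x - y * 9)" "\<not> (p dvd x - y * 4 \<and> p dvd x - y * 9)"
      by (rule diff, simp)+
    with * show False
      by blast
  qed
  then obtain m where m: "m \<in> {1, 2, 3}" "\<not> p dvd x + y * m\<^sup>2" "\<not> p dvd x - y * m\<^sup>2"
    by blast
  have "\<not> p dvd m"
    using m(1) p(2) by (auto dest!: zdvd_imp_le)
  have "\<not> p dvd b"
  proof
    assume "p dvd b"
    then have "p dvd y * b\<^sup>2"
      by (simp add: power2_eq_square)
    then show False
      using b nz(3) cong_dvd_iff by blast
  qed
  obtain c where c: "[(x + y * m\<^sup>2) * c = 1] (mod p)" "\<not> p dvd c"
    using prime_inverse_mod[OF p(1) m(2)] by blast
  \<comment> \<open>Substituting d = b + m a into x a^2 + y d^2 = y b^2 and cancelling a leaves (x +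
    y m^2) a = -2 y b m; \<open>c\<close> is the inverse of x + y m^2. The factor x - y m^2 of
    \<open>d\<close> explains the second condition on m.\<close>
  define a where "a = - 2 * y * b * m * c"
  define d where "d = b * (x - y * m\<^sup>2) * c"
  have "x * a\<^sup>2 + y * d\<^sup>2 = y * b\<^sup>2 * ((x + y * m\<^sup>2) * c)\<^sup>2"
    by (simp add: a_def d_def power2_eq_square algebra_simps)
  also have "[\<dots> = s * 1\<^sup>2] (mod p)"
    by (intro cong_mult cong_pow b c)
  finally have "[x * a\<^sup>2 + y * d\<^sup>2 = s] (mod p)"
    by simp
  moreover have "\<not> p dvd a" "\<not> p dvd d"
    using p(1) p2 nz m \<open>\<not> p dvd m\<close> \<open>\<not> p dvd b\<close> c(2)
    by (auto simp: a_def d_def prime_dvd_mult_iff)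
  ultimately show ?thesis
    by blast
qed

text \<open>A solution with a coordinate divisible by p lies on an axis, and
  \<open>conic_second_point\<close> moves it off both axes. By symmetry of the form this handles
  either coordinate.\<close>

lemma binary_form_represents_units:
  fixes p x y s :: int
  assumes p: "prime p" "p \<ge> 7" and nz: "\<not> p dvd x" "\<not> p dvd y" "\<not> p dvd s"
  shows "\<exists>a b. \<not> p dvd a \<and> \<not> p dvd b \<and> [x * a\<^sup>2 + y * b\<^sup>2 = s] (mod p)"
proof -
  obtain a b where ab: "[x * a\<^sup>2 + y * b\<^sup>2 = s] (mod p)"
    using binary_form_represents[of p x y s] p nz by auto
  have drop: "[v = s] (mod p)" if "p dvd u" "[u + v = s] (mod p)" for u v
    using that by (metis add_0 cong_0_iff cong_add cong_refl cong_sym cong_trans)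
  show ?thesis
  proof (cases "p dvd a")
    case True
    then have "[y * b\<^sup>2 = s] (mod p)"
      using drop[OF _ ab] by (simp add: power2_eq_square)
    then show ?thesis
      using conic_second_point[of p x y s b] p nz by blast
  next
    case False
    show ?thesis
    proof (cases "p dvd b")
      case True
      then have "[x * a\<^sup>2 = s] (mod p)"
        using drop[of "y * b\<^sup>2" "x * a\<^sup>2"] ab by (simp add: power2_eq_square add.commute)
      then show ?thesis
        using conic_second_point[of p y x s a] p nz by (metis add.commute)
    qed (use False ab in blast)
  qed
qed

text \<open>The binary form reaches only nonzero values, whereas t may be 0. The third variable
  repairs this: t - z and t - 4z differ by 3z, so c = 1 or c = 2 leaves a nonzero value for the
  first two variables.\<close>

lemma ternary_form_represents_units:
  fixes p x y z t :: int
  assumes p: "prime p" "p \<ge> 7" and nz: "\<not> p dvd x" "\<not> p dvd y" "\<not> p dvd z"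
  shows "\<exists>a b c. \<not> p dvd a \<and> \<not> p dvd b \<and> \<not> p dvd c \<and>
           [x * a\<^sup>2 + y * b\<^sup>2 + z * c\<^sup>2 = t] (mod p)"
proof -
  have "\<not> p dvd 3"
    using p(2) zdvd_imp_le[of p 3] by auto
  then have "\<not> p dvd 3 * z"
    using p(1) nz(3) by (simp add: prime_dvd_mult_iff)
  moreover have "3 * z = (t - z * 1\<^sup>2) - (t - z * 2\<^sup>2)"
    by simp
  ultimately have "\<not> p dvd t - z * 1\<^sup>2 \<or> \<not> p dvd t - z * 2\<^sup>2"
    by (metis dvd_diff)
  then obtain c where c: "c \<in> {1, 2}" "\<not> p dvd t - z * c\<^sup>2"
    by blast
  then obtain a b where ab: "\<not> p dvd a" "\<not> p dvd b" "[x * a\<^sup>2 + y * b\<^sup>2 = t - z * c\<^sup>2] (mod p)"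
    using binary_form_represents_units p nz by blast
  have "[x * a\<^sup>2 + y * b\<^sup>2 + z * c\<^sup>2 = t - z * c\<^sup>2 + z * c\<^sup>2] (mod p)"
    by (rule cong_add[OF ab(3) cong_refl])
  moreover have "\<not> p dvd c"
    using c(1) p(2) by (auto dest!: zdvd_imp_le)
  ultimately show ?thesis
    using ab by auto
qed

section \<open>Choosing weights modulo a single prime\<close>

text \<open>Start from any weights \<open>r\<close> with the right symbols. Multiplying three of
  them by squares preserves the symbols, and the resulting ternary form can be made to cancel the
  contribution \<open>t\<close> of all other terms.\<close>

lemma signed_weights_three_units:
  fixes p :: int and y e :: "'a \<Rightarrow> int"
  assumes p: "prime p" "p \<ge> 7" and I: "finite I" "{i, j, l} \<subseteq> I" "distinct [i, j, l]"
    and nz: "\<not> p dvd y i" "\<not> p dvd y j" "\<not> p dvd y l"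
    and e: "\<And>k. k \<in> I \<Longrightarrow> e k \<in> {1, -1}"
  shows "\<exists>w. (\<forall>k\<in>I. Legendre (w k) p = e k) \<and> [(\<Sum>k\<in>I. w k * y k) = 0] (mod p)"
proof -
  have "\<exists>r. Legendre r p = e k" if "k \<in> I" for k
    using exists_Legendre_eq[of p "e k"] p e[OF that] by auto
  then obtain r where r: "\<And>k. k \<in> I \<Longrightarrow> Legendre (r k) p = e k"
    by metis
  have r_nz: "\<not> p dvd r k" if "k \<in> I" for k
    using Legendre_nonzero r e that by metis
  define t where "t = (\<Sum>k\<in>I - {i, j, l}. r k * y k)"
  have "\<not> p dvd r k * y k" if "k \<in> {i, j, l}" for k
    using that r_nz I(2) nz p(1) by (auto simp: prime_dvd_mult_iff)
  then obtain a b c where abc: "\<not> p dvd a" "\<not> p dvd b" "\<not> p dvd c"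
    "[r i * y i * a\<^sup>2 + r j * y j * b\<^sup>2 + r l * y l * c\<^sup>2 = - t] (mod p)"
    using ternary_form_represents_units[of p "r i * y i" "r j * y j" "r l * y l" "- t"] p by blast
  define d where "d = (\<lambda>_. 1)(i := a, j := b, l := c)"
  have d: "d i = a" "d j = b" "d l = c" and d1: "d k = 1" if "k \<notin> {i, j, l}" for k
    using I(3) that by (auto simp: d_def)
  have "\<not> p dvd d k" for k
    using abc p(1) not_prime_unit[of p] by (auto simp: d_def)
  then have "Legendre (r k * (d k)\<^sup>2) p = e k" if "k \<in> I" for k
    using Legendre_mult_square[OF p(1)] r that by simp
  moreover have "[(\<Sum>k\<in>I. r k * (d k)\<^sup>2 * y k) = 0] (mod p)"
  proof -
    have "(\<Sum>k\<in>I. r k * (d k)\<^sup>2 * y k) =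
        (\<Sum>k\<in>I - {i, j, l}. r k * (d k)\<^sup>2 * y k) + (\<Sum>k\<in>{i, j, l}. r k * (d k)\<^sup>2 * y k)"
      using I by (intro sum.subset_diff) auto
    also have "(\<Sum>k\<in>I - {i, j, l}. r k * (d k)\<^sup>2 * y k) = t"
      unfolding t_def by (intro sum.cong) (auto simp: d_def)
    also have "(\<Sum>k\<in>{i, j, l}. r k * (d k)\<^sup>2 * y k) =
        r i * y i * a\<^sup>2 + r j * y j * b\<^sup>2 + r l * y l * c\<^sup>2"
      using I(3) by (simp add: d_def mult_ac)
    also have "[t + \<dots> = t + - t] (mod p)"
      by (rule cong_add[OF cong_refl abc(4)])
    finally show ?thesis
      by simp
  qed
  ultimately show ?thesis
    by (intro exI[of _ "\<lambda>k. r k * (d k)\<^sup>2"]) auto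
qed

text \<open>All weights are 1 except at i and j. The weight at j is forced by the sum, and it is
  nonzero once the weight a at i avoids \<open>t + a * y i\<close> = 0, which a = 1 and a = 2 cannot
  both violate. The symbols are left uncontrolled.\<close>

lemma weights_two_units:
  fixes p :: int and y :: "'a \<Rightarrow> int"
  assumes p: "prime p" "p > 2" and I: "finite I" "{i, j} \<subseteq> I" "i \<noteq> j"
    and nz: "\<not> p dvd y i" "\<not> p dvd y j"
  shows "\<exists>w. (\<forall>k\<in>I. \<not> p dvd w k) \<and> [(\<Sum>k\<in>I. w k * y k) = 0] (mod p)"
proof -
  define t where "t = (\<Sum>k\<in>I - {i, j}. y k)"
  have "y i = (t + 2 * y i) - (t + 1 * y i)"
    by simp
  then have "\<not> p dvd t + 1 * y i \<or> \<not> p dvd t + 2 * y i"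
    using nz(1) by (metis dvd_diff)
  then obtain a where a: "a \<in> {1, 2}" "\<not> p dvd t + a * y i"
    by blast
  obtain c where c: "[y j * c = 1] (mod p)" "\<not> p dvd c"
    using prime_inverse_mod[OF p(1) nz(2)] by blast
  define b where "b = - ((t + a * y i) * c)"
  have "[b * y j = - (t + a * y i) * (y j * c)] (mod p)"
    by (simp add: b_def algebra_simps)
  also have "[- (t + a * y i) * (y j * c) = - (t + a * y i) * 1] (mod p)"
    by (rule cong_scalar_left[OF c(1)])
  finally have b: "[b * y j = - (t + a * y i)] (mod p)"
    by simp
  define w where "w = (\<lambda>_. 1)(i := a, j := b)"
  have "\<not> p dvd a"
    using a(1) p by (auto dest!: zdvd_imp_le)
  moreover have "\<not> p dvd b"
    using a(2) c(2) by (simp only: b_def dvd_minus_iff prime_dvd_mult_iff[OF p(1)]) simp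
  ultimately have "\<not> p dvd w k" for k
    using p(1) not_prime_unit[of p] by (auto simp: w_def)
  moreover have "[(\<Sum>k\<in>I. w k * y k) = 0] (mod p)"
  proof -
    have "(\<Sum>k\<in>I. w k * y k) = (\<Sum>k\<in>I - {i, j}. w k * y k) + (\<Sum>k\<in>{i, j}. w k * y k)"
      using I by (intro sum.subset_diff) auto
    also have "(\<Sum>k\<in>I - {i, j}. w k * y k) = t"
      unfolding t_def by (intro sum.cong) (auto simp: w_def)
    also have "t + (\<Sum>k\<in>{i, j}. w k * y k) = t + a * y i + b * y j"
      using I(3) by (simp add: w_def)
    also have "[\<dots> = t + a * y i + - (t + a * y i)] (mod p)"
      by (rule cong_add[OF cong_refl b])
    finally show ?thesis
      by simp
  qed
  ultimately show ?thesis
    by blast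
qed

section \<open>Assembling weights modulo a squarefree number\<close>

lemma prime_factorization_squarefree:
  fixes n :: nat
  assumes "squarefree n"
  shows "prime_factorization n = mset_set (prime_factors n)"
proof (rule multiset_eqI)
  fix p
  have "n \<noteq> 0"
    using assms by (rule contrapos_pn) simp
  then have "\<forall>p\<in>prime_factors n. multiplicity p n = 1"
    using assms squarefree_factorial_semiring' by blast
  then show "count (prime_factorization n) p = count (mset_set (prime_factors n)) p"
    by (cases "p \<in> prime_factors n")
      (simp_all add: count_mset_set' count_prime_factorization_prime in_prime_factors_imp_prime not_in_iff)
qed

text \<open>Turns the multiset product in \<open>Jacobi\<close> into a product over a set, from
  which the factor of one prime can be split off.\<close>

lemma prod_mset_squarefree:
  fixes n :: nat
  assumes "squarefree n"
  shows "(\<Prod>p\<in>#prime_factorization n. f p) = (\<Prod>p\<in>prime_factors n. f p)"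
proof -
  have "(\<Prod>p\<in>prime_factors n. f p) = (\<Prod>p\<in>#mset_set (prime_factors n). f p)"
    by (rule prod_unfold_prod_mset)
  also have "mset_set (prime_factors n) = prime_factorization n"
    by (rule prime_factorization_squarefree[OF assms, symmetric])
  finally show ?thesis
    by (rule sym)
qed

lemma prod_prime_factors_squarefree:
  fixes n :: nat
  assumes "squarefree n"
  shows "int n = (\<Prod>p\<in>prime_factors n. int p)"
proof -
  have "n \<noteq> 0"
    using assms by (rule contrapos_pn) simp
  then have "n = prod_mset (prime_factorization n)"
    by (simp add: prod_mset_prime_factorization_nat)
  also have "\<dots> = (\<Prod>p\<in>prime_factors n. p)"
    using prod_mset_squarefree[OF assms, of "\<lambda>p. p"] by simp
  finally have "int n = int (\<Prod>p\<in>prime_factors n. p)"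
    by (rule arg_cong)
  also have "\<dots> = (\<Prod>p\<in>prime_factors n. int p)"
    by (rule of_nat_prod)
  finally show ?thesis .
qed

lemma Jacobi_squarefree:
  assumes "squarefree n"
  shows "Jacobi a n = (\<Prod>p\<in>prime_factors n. Legendre a (int p))"
  unfolding Jacobi_def by (rule prod_mset_squarefree[OF assms])

lemma coprime_prime_factors:
  "p \<in> prime_factors n \<Longrightarrow> q \<in> prime_factors n \<Longrightarrow> p \<noteq> q \<Longrightarrow> coprime (int p) (int q)"
  using primes_coprime[of p q] by auto

lemma cong_squarefree:
  assumes "squarefree n" "\<And>p. p \<in> prime_factors n \<Longrightarrow> [x = y] (mod int p)"
  shows "[x = y] (mod int n)"
  unfolding prod_prime_factors_squarefree[OF assms(1)]
  by (rule cong_cong_prod_coprime) (use assms(2) coprime_prime_factors in blast)+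

lemma coprime_squarefree_iff:
  assumes "squarefree n"
  shows "coprime x (int n) \<longleftrightarrow> (\<forall>p\<in>prime_factors n. \<not> int p dvd x)"
proof
  assume "coprime x (int n)"
  then show "\<forall>p\<in>prime_factors n. \<not> int p dvd x"
    by (metis coprime_common_divisor in_prime_factors_iff int_dvd_int_iff not_prime_unit
        prime_nat_int_transfer)
next
  assume *: "\<forall>p\<in>prime_factors n. \<not> int p dvd x"
  show "coprime x (int n)"
    unfolding prod_prime_factors_squarefree[OF assms]
  proof (rule prod_coprime_right)
    fix p assume "p \<in> prime_factors n"
    with * show "coprime x (int p)"
      by (metis coprime_commute in_prime_factors_iff prime_imp_coprime prime_nat_int_transfer)
  qed
qed

lemma chinese_remainder_prime_factors:
  "\<exists>x. \<forall>p\<in>prime_factors n. [x = u p] (mod int p)"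
proof -
  have "\<exists>x. \<forall>p\<in>prime_factors n. [x = nat (u p mod int p)] (mod p)"
    by (rule chinese_remainder_nat) (use coprime_prime_factors in auto)
  then obtain x where x: "\<And>p. p \<in> prime_factors n \<Longrightarrow> [x = nat (u p mod int p)] (mod p)"
    by blast
  have "[int x = u p] (mod int p)" if p: "p \<in> prime_factors n" for p
  proof -
    have "p > 0"
      using p by (intro prime_gt_0_nat) auto
    then have "[int x = u p mod int p] (mod int p)"
      using x[OF p] by (simp flip: cong_int_iff)
    then show ?thesis
      by simp
  qed
  then show ?thesis
    by blast
qed

section \<open>Weights with Jacobi symbol 1\<close>

text \<open>Here \<open>w p i\<close> is the weight of term i modulo p, and the Chinese remainder
  theorem glues these local weights. Only the hypothesis \<open>one\<close> links different
  primes.\<close>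

lemma weighted_zero_sum_Jacobi_oneI:
  assumes n: "squarefree n" and "ys \<noteq> []"
    and unit: "\<And>p i. p \<in> prime_factors n \<Longrightarrow> i < length ys \<Longrightarrow> \<not> int p dvd w p i"
    and zero: "\<And>p. p \<in> prime_factors n \<Longrightarrow> [(\<Sum>i<length ys. w p i * ys ! i) = 0] (mod int p)"
    and one: "\<And>i. i < length ys \<Longrightarrow> (\<Prod>p\<in>prime_factors n. Legendre (w p i) (int p)) = 1"
  shows "weighted_zero_sum n (Jacobi_one_residues n) ys"
proof -
  have "n > 0"
    using n by (metis gr0I not_squarefree_0)
  obtain a where a: "\<And>i p. p \<in> prime_factors n \<Longrightarrow> [a i = w p i] (mod int p)"
    using chinese_remainder_prime_factors[of n "\<lambda>p. w p i" for i] by metis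
  define b where "b i = a i mod int n" for i
  have b: "[b i = w p i] (mod int p)" if "p \<in> prime_factors n" for i p
  proof -
    have "int p dvd int n"
      using that by auto
    then have "[b i = a i] (mod int p)"
      by (simp add: b_def cong_def mod_mod_cancel)
    with a[OF that] show ?thesis
      using cong_trans by blast
  qed
  have "b i \<in> Jacobi_one_residues n" if i: "i < length ys" for i
  proof -
    have "b i \<in> Zmod n"
      using \<open>n > 0\<close> by (simp add: b_def Zmod_def)
    moreover have "coprime (b i) (int n)"
      using b unit i by (metis coprime_squarefree_iff[OF n] cong_dvd_iff)
    moreover have "Jacobi (b i) n = (\<Prod>p\<in>prime_factors n. Legendre (w p i) (int p))"
      unfolding Jacobi_squarefree[OF n] by (intro prod.cong refl Legendre_cong b)
    ultimately show ?thesis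
      using one[OF i] \<open>n > 0\<close> by (simp add: Jacobi_one_residues_def unit_residues_eq_coprime)
  qed
  moreover have "[(\<Sum>i<length ys. map b [0..<length ys] ! i * ys ! i) = 0] (mod int n)"
  proof (rule cong_squarefree[OF n])
    fix p assume p: "p \<in> prime_factors n"
    have "(\<Sum>i<length ys. map b [0..<length ys] ! i * ys ! i) = (\<Sum>i<length ys. b i * ys ! i)"
      by simp
    also have "[\<dots> = (\<Sum>i<length ys. w p i * ys ! i)] (mod int p)"
      by (intro cong_sum cong_scalar_right b p)
    finally show "[(\<Sum>i<length ys. map b [0..<length ys] ! i * ys ! i) = 0] (mod int p)"
      using zero[OF p] cong_trans by blast
  qed
  ultimately show ?thesis
    using \<open>ys \<noteq> []\<close> unfolding weighted_zero_sum_def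
    by (intro conjI exI[of _ "map b [0..<length ys]"]) auto
qed

lemma prod_signs:
  fixes f :: "'a \<Rightarrow> int"
  assumes "\<And>x. x \<in> A \<Longrightarrow> f x \<in> {1, -1}"
  shows "prod f A \<in> {1, -1}"
  using assms by (induction A rule: infinite_finite_induct) (simp, simp, fastforce)

text \<open>Scaling by a unit preserves the zero-sum and makes the weight at \<open>i0\<close> equal
  to 1. Every other term is divisible by some prime \<open>q i\<close>, so modulo \<open>q i\<close>
  its weight does not affect the sum and can be replaced to correct the Jacobi symbol.\<close>

lemma weighted_zero_sum_Jacobi_one_few_units:
  assumes n: "squarefree n" and ge: "\<And>p. p \<in> prime_factors n \<Longrightarrow> p > 2"
    and ys: "weighted_zero_sum n (unit_residues n) ys"
    and few: "\<And>i. i < length ys \<Longrightarrow> i \<noteq> i0 \<Longrightarrow> \<not> coprime (ys ! i) (int n)"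
  shows "weighted_zero_sum n (Jacobi_one_residues n) ys"
proof -
  let ?P = "prime_factors n"
  have "n > 0"
    using n by (metis gr0I not_squarefree_0)
  have prime: "prime (int p)" if "p \<in> ?P" for p
    using that by auto
  obtain as where as: "length as = length ys" "set as \<subseteq> unit_residues n"
    "[(\<Sum>i<length ys. as ! i * ys ! i) = 0] (mod int n)" and "ys \<noteq> []"
    using ys by (auto simp: weighted_zero_sum_def)
  have as_unit: "coprime (as ! i) (int n)" if "i < length ys" for i
  proof -
    have "as ! i \<in> unit_residues n"
      using that as(1,2) nth_mem by fastforce
    then show ?thesis
      by (simp add: unit_residues_eq_coprime[OF \<open>n > 0\<close>])
  qed
  \<comment> \<open>The inverse of the weight at \<open>i0\<close>. An index \<open>i0\<close>
    beyond the list is allowed, and then no scaling is done (c = 1).\<close>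
  obtain c where c: "coprime c (int n)" "i0 < length ys \<Longrightarrow> [c * as ! i0 = 1] (mod int n)"
  proof (cases "i0 < length ys")
    case True
    then obtain c where c: "[as ! i0 * c = 1] (mod int n)"
      using as_unit coprime_iff_invertible_int by blast
    then have "coprime c (int n)"
      by (metis coprime_iff_invertible_int mult.commute)
    with c that show ?thesis
      by (metis mult.commute)
  qed (use that[of 1] in auto)
  define b where "b i = c * as ! i" for i
  have b_unit: "\<not> int p dvd b i" if "p \<in> ?P" "i < length ys" for p i
  proof -
    have "coprime (b i) (int n)"
      using c(1) as_unit that by (simp add: b_def)
    with that(1) show ?thesis
      by (simp add: coprime_squarefree_iff[OF n])
  qed
  have "\<exists>q\<in>?P. int q dvd ys ! i" if "i < length ys" "i \<noteq> i0" for i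
    using few[OF that] by (simp add: coprime_squarefree_iff[OF n])
  then obtain q where q: "\<And>i. i < length ys \<Longrightarrow> i \<noteq> i0 \<Longrightarrow> q i \<in> ?P"
    "\<And>i. i < length ys \<Longrightarrow> i \<noteq> i0 \<Longrightarrow> int (q i) dvd ys ! i"
    by metis
  \<comment> \<open>This is a sign, hence its own inverse: giving the weight the symbol
    \<open>e i\<close> at \<open>q i\<close> makes the full product 1.\<close>
  define e where "e i = (\<Prod>p\<in>?P - {q i}. Legendre (b i) (int p))" for i
  have e: "e i \<in> {1, -1}" if "i < length ys" for i
    unfolding e_def by (intro prod_signs Legendre_unit b_unit that) auto
  have "\<exists>v. Legendre v (int (q i)) = e i" if "i < length ys" "i \<noteq> i0" for i
    using q(1)[OF that] ge by (intro exists_Legendre_eq prime e that) (force+)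
  then obtain v where v: "\<And>i. i < length ys \<Longrightarrow> i \<noteq> i0 \<Longrightarrow> Legendre (v i) (int (q i)) = e i"
    by metis
  define w where "w p i = (if i \<noteq> i0 \<and> p = q i then v i else b i)" for p i
  show ?thesis
  proof (rule weighted_zero_sum_Jacobi_oneI[OF n \<open>ys \<noteq> []\<close>, of w])
    fix p i assume p: "p \<in> ?P" and i: "i < length ys"
    show "\<not> int p dvd w p i"
      using b_unit[OF p i] Legendre_nonzero[of "v i" "int p"] v[OF i] e[OF i] by (auto simp: w_def)
  next
    fix p assume p: "p \<in> ?P"
    have "[w p i * ys ! i = b i * ys ! i] (mod int p)" if "i < length ys" for i
    proof (cases "i \<noteq> i0 \<and> p = q i")
      case True
      then have "int p dvd ys ! i"
        using q that by blast
      then show ?thesis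
        by (metis cong_0_iff cong_sym cong_trans dvd_mult)
    qed (auto simp: w_def)
    then have "[(\<Sum>i<length ys. w p i * ys ! i) = (\<Sum>i<length ys. b i * ys ! i)] (mod int p)"
      by (intro cong_sum) auto
    also have "(\<Sum>i<length ys. b i * ys ! i) = c * (\<Sum>i<length ys. as ! i * ys ! i)"
      by (simp add: b_def sum_distrib_left mult_ac)
    also have "[c * (\<Sum>i<length ys. as ! i * ys ! i) = c * 0] (mod int p)"
      by (intro cong_scalar_left cong_dvd_modulus[OF as(3)]) (use p in auto)
    finally show "[(\<Sum>i<length ys. w p i * ys ! i) = 0] (mod int p)"
      by simp
  next
    fix i assume i: "i < length ys"
    show "(\<Prod>p\<in>?P. Legendre (w p i) (int p)) = 1"
    proof (cases "i = i0")
      case True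
      have "[b i0 = 1] (mod int p)" if "p \<in> ?P" for p
      proof -
        have "int p dvd int n"
          using that by auto
        with c(2) i True show ?thesis
          unfolding b_def using cong_dvd_modulus by blast
      qed
      then have "Legendre (w p i) (int p) = 1" if "p \<in> ?P" for p
        using that Legendre_cong[of "b i0" 1 "int p"] Legendre_1[OF prime] True by (simp add: w_def)
      then show ?thesis
        by (intro prod.neutral) blast
    next
      case False
      have "(\<Prod>p\<in>?P. Legendre (w p i) (int p)) =
          Legendre (w (q i) i) (int (q i)) * (\<Prod>p\<in>?P - {q i}. Legendre (w p i) (int p))"
        by (rule prod.remove) (use q(1) i False in auto)
      also have "(\<Prod>p\<in>?P - {q i}. Legendre (w p i) (int p)) = e i"
        unfolding e_def by (intro prod.cong) (auto simp: w_def)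
      also have "Legendre (w (q i) i) (int (q i)) = e i"
        using v[OF i False] False by (simp add: w_def)
      finally show ?thesis
        using e[OF i] by auto
    qed
  qed
qed

text \<open>The two units give a zero-sum modulo every prime with uncontrolled symbols. At one prime
  not dividing the third term there are three terms prime to it, and there the symbols can be
  prescribed to correct all weights at once.\<close>

lemma weighted_zero_sum_Jacobi_one_two_units:
  assumes n: "squarefree n" and ge: "\<And>p. p \<in> prime_factors n \<Longrightarrow> p \<ge> 7"
    and ijl: "i < length ys" "j < length ys" "l < length ys" "distinct [i, j, l]"
    and unit: "coprime (ys ! i) (int n)" "coprime (ys ! j) (int n)"
    and nz: "\<not> [ys ! l = 0] (mod int n)"
  shows "weighted_zero_sum n (Jacobi_one_residues n) ys"
proof -
  let ?P = "prime_factors n" and ?I = "{..<length ys}"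
  have prime: "prime (int p)" if "p \<in> ?P" for p
    using that by auto
  have unit_p: "\<not> int p dvd ys ! i" "\<not> int p dvd ys ! j" if "p \<in> ?P" for p
    using unit that by (auto simp: coprime_squarefree_iff[OF n])
  have "\<exists>u. (\<forall>k\<in>?I. \<not> int p dvd u k) \<and> [(\<Sum>k\<in>?I. u k * ys ! k) = 0] (mod int p)"
    if p: "p \<in> ?P" for p
    using ge[OF p] ijl by (intro weights_two_units[of "int p" ?I i j] prime p unit_p) auto
  then obtain u where u: "\<And>p k. p \<in> ?P \<Longrightarrow> k \<in> ?I \<Longrightarrow> \<not> int p dvd u p k"
    "\<And>p. p \<in> ?P \<Longrightarrow> [(\<Sum>k\<in>?I. u p k * ys ! k) = 0] (mod int p)"
    by metis
  \<comment> \<open>If every prime factor divided \<open>ys ! l\<close>, so would the squarefree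
    number n.\<close>
  obtain p where p: "p \<in> ?P" "\<not> int p dvd ys ! l"
    using nz cong_squarefree[OF n, of "ys ! l" 0] by (auto simp: cong_0_iff)
  define e where "e k = (\<Prod>q\<in>?P - {p}. Legendre (u q k) (int q))" for k
  have e: "e k \<in> {1, -1}" if "k \<in> ?I" for k
    unfolding e_def using that by (intro prod_signs Legendre_unit u) auto
  have "\<exists>v. (\<forall>k\<in>?I. Legendre (v k) (int p) = e k) \<and> [(\<Sum>k\<in>?I. v k * ys ! k) = 0] (mod int p)"
    using ge[OF p(1)] ijl e
    by (intro signed_weights_three_units[of "int p" ?I i j l] prime p unit_p) auto
  then obtain v where v: "\<And>k. k \<in> ?I \<Longrightarrow> Legendre (v k) (int p) = e k"
    "[(\<Sum>k\<in>?I. v k * ys ! k) = 0] (mod int p)"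
    by blast
  define w where "w = u(p := v)"
  show ?thesis
  proof (rule weighted_zero_sum_Jacobi_oneI[OF n, of ys w])
    show "ys \<noteq> []"
      using ijl by auto
    show "\<not> int q dvd w q k" if "q \<in> ?P" "k < length ys" for q k
      using u(1)[OF that(1)] Legendre_nonzero[of "v k" "int p"] v(1)[of k] e[of k] that
      by (auto simp: w_def)
    show "[(\<Sum>k\<in>?I. w q k * ys ! k) = 0] (mod int q)" if "q \<in> ?P" for q
      using u(2) v(2) that by (simp add: w_def)
  next
    fix k assume k: "k < length ys"
    have "(\<Prod>q\<in>?P. Legendre (w q k) (int q)) =
        Legendre (w p k) (int p) * (\<Prod>q\<in>?P - {p}. Legendre (w q k) (int q))"
      by (rule prod.remove) (use p in auto)
    also have "(\<Prod>q\<in>?P - {p}. Legendre (w q k) (int q)) = e k"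
      unfolding e_def by (intro prod.cong) (auto simp: w_def)
    also have "Legendre (w p k) (int p) = e k"
      using v(1) k by (simp add: w_def)
    finally show "(\<Prod>q\<in>?P. Legendre (w q k) (int q)) = 1"
      using e[of k] k by auto
  qed
qed

lemma one_Jacobi_one_residue:
  assumes "n > 1"
  shows "1 \<in> Jacobi_one_residues n"
proof -
  have "Legendre 1 (int p) = 1" if "p \<in> prime_factors n" for p
    using that by (intro Legendre_1) auto
  then have "Jacobi 1 n = 1"
    unfolding Jacobi_def by (intro prod_mset.neutral) auto
  then show ?thesis
    using assms by (simp add: Jacobi_one_residues_def unit_residues_eq_coprime Zmod_def)
qed

lemma has_consecutive_zero_sum_mono:
  assumes "has_consecutive_zero_sum n A zs" "sublist zs ys" "A \<subseteq> B"
  shows "has_consecutive_zero_sum n B ys"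
  using assms unfolding has_consecutive_zero_sum_def weighted_zero_sum_def
  by (meson dual_order.trans sublist_order.order.trans)

text \<open>Length at least 3 guarantees a further term beside two units. In that case the block
  becomes the whole sequence, while with at most one unit the given block is kept and only its
  weights change.\<close>

lemma has_consecutive_zero_sum_Jacobi_one_iff:
  assumes n: "squarefree n" "n > 1" and ge: "\<And>p. p \<in> prime_factors n \<Longrightarrow> p \<ge> 7"
    and ys: "set ys \<subseteq> Zmod n" "length ys \<ge> 3"
  shows "has_consecutive_zero_sum n (Jacobi_one_residues n) ys \<longleftrightarrow>
         has_consecutive_zero_sum n (unit_residues n) ys"
proof
  assume "has_consecutive_zero_sum n (Jacobi_one_residues n) ys"
  then show "has_consecutive_zero_sum n (unit_residues n) ys"
    by (rule has_consecutive_zero_sum_mono) (auto simp: Jacobi_one_residues_def)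
next
  assume "has_consecutive_zero_sum n (unit_residues n) ys"
  then obtain zs where zs: "sublist zs ys" "weighted_zero_sum n (unit_residues n) zs"
    by (auto simp: has_consecutive_zero_sum_def)
  obtain us vs where ys_eq: "ys = us @ zs @ vs"
    using zs(1) by (auto simp: sublist_def)
  consider "0 \<in> set ys"
    | (two) i j where "0 \<notin> set ys" "i < length ys" "j < length ys" "i \<noteq> j"
        "coprime (ys ! i) (int n)" "coprime (ys ! j) (int n)"
    | (few) "\<And>i j. i < length ys \<Longrightarrow> j < length ys \<Longrightarrow> i \<noteq> j \<Longrightarrow>
        \<not> (coprime (ys ! i) (int n) \<and> coprime (ys ! j) (int n))"
    by blast
  then show "has_consecutive_zero_sum n (Jacobi_one_residues n) ys"
  proof cases
    case 1
    then have "sublist [0] ys"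
      by (auto simp: sublist_def dest: split_list)
    moreover have "weighted_zero_sum n (Jacobi_one_residues n) [0]"
      unfolding weighted_zero_sum_def using one_Jacobi_one_residue[OF n(2)]
      by (intro conjI exI[of _ "[1]"]) auto
    ultimately show ?thesis
      by (auto simp: has_consecutive_zero_sum_def)
  next
    case two
    obtain l where l: "l < length ys" "distinct [i, j, l]"
    proof -
      have "\<exists>l\<in>{0, 1, 2}. l \<noteq> i \<and> l \<noteq> j"
        by auto
      then obtain l where "l \<in> {0, 1, 2}" "l \<noteq> i" "l \<noteq> j"
        by blast
      with ys(2) two(4) show thesis
        by (intro that[of l]) auto
    qed
    have "ys ! l \<in> Zmod n" "ys ! l \<noteq> 0"
      using ys(1) two(1) nth_mem[OF l(1)] by (blast, metis)
    then have "\<not> [ys ! l = 0] (mod int n)"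
      by (simp add: Zmod_def cong_def)
    then have "weighted_zero_sum n (Jacobi_one_residues n) ys"
      using weighted_zero_sum_Jacobi_one_two_units[OF n(1) ge] two l by blast
    then show ?thesis
      by (auto simp: has_consecutive_zero_sum_def)
  next
    case few
    have few_zs: "\<not> (coprime (zs ! i) (int n) \<and> coprime (zs ! j) (int n))"
      if "i < length zs" "j < length zs" "i \<noteq> j" for i j
      using few[of "length us + i" "length us + j"] that by (simp add: ys_eq nth_append)
    obtain i0 where "\<And>i. i < length zs \<Longrightarrow> i \<noteq> i0 \<Longrightarrow> \<not> coprime (zs ! i) (int n)"
    proof (cases "\<exists>i<length zs. coprime (zs ! i) (int n)")
      case True
      then obtain i0 where "i0 < length zs" "coprime (zs ! i0) (int n)"
        by blast
      then show ?thesis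
        using few_zs that by blast
    qed (use that in blast)
    then have "weighted_zero_sum n (Jacobi_one_residues n) zs"
      using ge by (intro weighted_zero_sum_Jacobi_one_few_units[OF n(1) _ zs(2)]) force+
    then show ?thesis
      using zs(1) by (auto simp: has_consecutive_zero_sum_def)
  qed
qed

section \<open>The extremal sequences\<close>

text \<open>Two of the n + 1 partial sums, the empty one included, agree modulo n, and the block
  between them sums to 0 with all weights 1. This ensures that the least element defining
  \<open>C_const\<close> exists.\<close>

lemma has_consecutive_zero_sum_length:
  assumes "n > 0" "1 \<in> A" "length ys = n"
  shows "has_consecutive_zero_sum n A ys"
proof -
  define s where "s k = (\<Sum>i<k. ys ! i) mod int n" for k
  have "s ` {..n} \<subseteq> {0..<int n}"
    using assms(1) by (auto simp: s_def)
  then have "card (s ` {..n}) \<le> n"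
    using card_mono[of "{0..<int n}" "s ` {..n}"] by simp
  then have "\<not> inj_on s {..n}"
    by (intro pigeonhole) simp
  then obtain a b where ab: "a < b" "b \<le> n" "s a = s b"
    by (metis atMost_iff inj_onI linorder_neqE_nat)
  define zs where "zs = take (b - a) (drop a ys)"
  have len: "length zs = b - a"
    using ab assms(3) by (simp add: zs_def)
  have "{..<b} = {..<a} \<union> {a..<b}"
    using ab by auto
  then have "(\<Sum>i<b. ys ! i) = (\<Sum>i<a. ys ! i) + (\<Sum>i=a..<b. ys ! i)"
    by (simp add: sum.union_disjoint ivl_disj_int)
  also have "(\<Sum>i=a..<b. ys ! i) = (\<Sum>i<b - a. ys ! (a + i))"
    by (rule sum.reindex_bij_witness[of _ "\<lambda>i. a + i" "\<lambda>i. i - a"]) auto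
  also have "\<dots> = (\<Sum>i<length zs. replicate (length zs) 1 ! i * zs ! i)"
    using ab assms(3) by (simp add: len) (simp add: zs_def)
  finally have "[(\<Sum>i<length zs. replicate (length zs) 1 ! i * zs ! i) = 0] (mod int n)"
    using ab(3) by (simp add: s_def cong_iff_dvd_diff mod_eq_dvd_iff flip: cong_def)
  then have "weighted_zero_sum n A zs"
    unfolding weighted_zero_sum_def using len ab assms(2)
    by (intro conjI exI[of _ "replicate (length zs) 1"]) auto
  moreover have "sublist zs ys"
    by (metis zs_def sublist_drop sublist_order.order.trans sublist_take)
  ultimately show ?thesis
    by (auto simp: has_consecutive_zero_sum_def)
qed

text \<open>In a block containing the term 1, only the unit weight of that term survives modulo p.
  The only other nonempty block is a single p, whose weighted value is nonzero modulo q. Contiguity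
  matters: the scattered pair p, p has the zero-sum p - p.\<close>

lemma no_consecutive_zero_sum_prime_1_prime:
  assumes n: "n > 0" and p: "prime p" "p dvd n" and q: "prime q" "q dvd n" and "p \<noteq> q"
  shows "\<not> has_consecutive_zero_sum n (unit_residues n) [int p, 1, int p]"
proof
  assume "has_consecutive_zero_sum n (unit_residues n) [int p, 1, int p]"
  then obtain zs where zs: "sublist zs [int p, 1, int p]" "weighted_zero_sum n (unit_residues n) zs"
    by (auto simp: has_consecutive_zero_sum_def)
  then obtain as where as: "length as = length zs" "set as \<subseteq> unit_residues n"
    "[(\<Sum>i<length zs. as ! i * zs ! i) = 0] (mod int n)" and "zs \<noteq> []"
    by (auto simp: weighted_zero_sum_def)
  have dvd: "int r dvd (\<Sum>i<length zs. as ! i * zs ! i)" if "r dvd n" for r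
    using as(3) that by (meson cong_0_iff cong_dvd_modulus int_dvd_int_iff)
  have unit: "\<not> int r dvd a" if "prime r" "r dvd n" "a \<in> unit_residues n" for r a
    using that unit_residues_eq_coprime[OF n] coprime_common_divisor[of a "int n" "int r"]
    by (auto dest: not_prime_unit)
  have "\<not> int q dvd int p"
    using p(1) q(1) \<open>p \<noteq> q\<close> by (simp add: primes_dvd_imp_eq) (metis primes_dvd_imp_eq)
  then have q': "\<not> int q dvd a * int p" if "a \<in> unit_residues n" for a
    using unit[OF q that] q(1) by (simp add: prime_dvd_mult_iff)
  from zs(1) \<open>zs \<noteq> []\<close> consider "zs = [int p]" | "zs = [1]" | "zs = [int p, 1]" | "zs = [1, int p]"
    | "zs = [int p, 1, int p]"
    by (auto simp: sublist_Cons_right prefix_Cons)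
  then show False
  proof cases
    case 1
    then obtain a where "as = [a]"
      using as(1) by (auto simp: length_Suc_conv)
    with 1 show ?thesis
      using dvd[OF q(2)] q' as(2) by simp
  next
    case 2
    then obtain a where "as = [a]"
      using as(1) by (auto simp: length_Suc_conv)
    with 2 show ?thesis
      using dvd[OF p(2)] unit[OF p] as(2) by simp
  next
    case 3
    then obtain a b where "as = [a, b]"
      using as(1) by (auto simp: length_Suc_conv)
    with 3 show ?thesis
      using dvd[OF p(2)] unit[OF p] as(2) by (simp add: lessThan_Suc dvd_add_left_iff)
  next
    case 4
    then obtain a b where "as = [a, b]"
      using as(1) by (auto simp: length_Suc_conv)
    with 4 show ?thesis
      using dvd[OF p(2)] unit[OF p] as(2) by (simp add: lessThan_Suc dvd_add_right_iff)
  next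
    case 5
    then obtain a b c where "as = [a, b, c]"
      using as(1) by (auto simp: length_Suc_conv)
    with 5 show ?thesis
      using dvd[OF p(2)] unit[OF p] as(2)
      by (simp add: lessThan_Suc numeral_3_eq_3 dvd_add_left_iff dvd_add_right_iff)
  qed
qed

text \<open>The cofactor n/p exceeds 1 because n is not prime, and its prime factors differ from p
  because p^2 does not divide n.\<close>

lemma squarefree_two_prime_factors:
  fixes n :: nat
  assumes "squarefree n" "n > 1" "\<not> prime n"
  obtains p q where "prime p" "p dvd n" "prime q" "q dvd n" "p \<noteq> q"
proof -
  obtain p where p: "prime p" "p dvd n"
    using assms(2) prime_factor_nat[of n] by auto
  then obtain m where m: "n = p * m"
    by auto
  with assms(3) p have "m \<noteq> 1"
    by auto
  then obtain q where q: "prime q" "q dvd m"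
    using prime_factor_nat by blast
  have "p \<noteq> q"
  proof
    assume "p = q"
    with q m have "p\<^sup>2 dvd n"
      by (auto simp: power2_eq_square)
    with assms(1) p(1) show False
      using squarefreeD not_prime_unit by blast
  qed
  with p q m that show thesis
    by simp
qed

theorem theorem4p1:
  fixes n :: nat and ys :: "int list"
  assumes "n > 0" and "squarefree n" and "\<not> prime n"
    and "\<And>p. prime p \<Longrightarrow> p dvd n \<Longrightarrow> p \<ge> 7"
  shows "C_extremal n (Jacobi_one_residues n) ys \<longleftrightarrow> C_extremal n (unit_residues n) ys"
proof (cases "n = 1")
  case True
  \<comment> \<open>For n = 1 the Jacobi symbol is an empty product, so it equals 1
    everywhere.\<close>
  then have "Jacobi_one_residues n = unit_residues n"
    by (simp add: Jacobi_one_residues_def Jacobi_def)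
  then show ?thesis
    by simp
next
  case False
  with assms(1) have n: "n > 1"
    by simp
  let ?U = "unit_residues n" and ?S = "Jacobi_one_residues n"
  \<comment> \<open>The condition minimised by \<open>C_const\<close>, named so that it can be
    compared for both weight sets one length at a time.\<close>
  define good where "good A k \<longleftrightarrow> k > 0 \<and>
    (\<forall>ys. set ys \<subseteq> Zmod n \<and> length ys = k \<longrightarrow> has_consecutive_zero_sum n A ys)" for A k
  have C: "C_const n A = (LEAST k. good A k)" for A
    by (simp add: C_const_def good_def)
  have S_sub_U: "?S \<subseteq> ?U"
    by (auto simp: Jacobi_one_residues_def)
  have long: "has_consecutive_zero_sum n ?S xs \<longleftrightarrow> has_consecutive_zero_sum n ?U xs"
    if "set xs \<subseteq> Zmod n" "length xs \<ge> 3" for xs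
    using has_consecutive_zero_sum_Jacobi_one_iff[OF assms(2) n _ that] assms(4)
    by (auto simp: in_prime_factors_iff)
  obtain p q where pq: "prime p" "p dvd n" "prime q" "q dvd n" "p \<noteq> q"
    using squarefree_two_prime_factors[OF assms(2) n assms(3)] .
  \<comment> \<open>A prefix of (p, 1, p) inherits the absence of zero-sum blocks, so every length
    up to 3 is excluded by one sequence.\<close>
  have short_U: "\<not> good ?U k" if "k \<le> 3" for k
  proof
    assume good: "good ?U k"
    let ?xs = "take k [int p, 1, int p]"
    have "p \<le> n" "p \<noteq> n"
      using pq(1,2) assms(1,3) by (auto dest: dvd_imp_le)
    then have "set [int p, 1, int p] \<subseteq> Zmod n"
      using n by (simp add: Zmod_def)
    then have "set ?xs \<subseteq> Zmod n"
      by (rule subset_trans[OF set_take_subset])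
    moreover have "length ?xs = k"
      using that by simp
    ultimately have "has_consecutive_zero_sum n ?U ?xs"
      using good unfolding good_def by blast
    then have "has_consecutive_zero_sum n ?U [int p, 1, int p]"
      by (rule has_consecutive_zero_sum_mono) (use sublist_take in auto)
    with no_consecutive_zero_sum_prime_1_prime[OF assms(1) pq] show False
      by blast
  qed
  have S_imp_U: "good ?U k" if "good ?S k" for k
    using that has_consecutive_zero_sum_mono[OF _ sublist_order.order.refl S_sub_U]
    unfolding good_def by blast
  \<comment> \<open>Up to length 3 both sides are false, the left one because weights in
    \<open>?S\<close> are also weights in \<open>?U\<close>; from length 3 on \<open>long\<close>
    applies.\<close>
  have "good ?S k = good ?U k" for k
  proof (cases "k \<le> 3")
    case True
    with short_U[OF this] S_imp_U[of k] show ?thesis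
      by blast
  next
    case False
    then have "length xs = k \<Longrightarrow> length xs \<ge> 3" for xs :: "int list"
      by simp
    with long show ?thesis
      unfolding good_def by blast
  qed
  then have C_eq: "C_const n ?S = C_const n ?U"
    by (simp add: C)
  have "1 \<in> ?U"
    using one_Jacobi_one_residue[OF n] S_sub_U by blast
  then have "good ?U n"
    using has_consecutive_zero_sum_length[OF assms(1)] assms(1) unfolding good_def by blast
  then have "good ?U (C_const n ?U)"
    unfolding C by (rule LeastI)
  \<comment> \<open>The constant is at least 4, so extremal sequences have length at least 3,
    exactly the range covered by \<open>long\<close>.\<close>
  then have "C_const n ?U - 1 \<ge> 3"
    using short_U[of "C_const n ?U"] by linarith
  then show ?thesis
    using long[of ys] by (auto simp: C_extremal_def C_eq)
qed

end
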